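(* Let $H$ be a real Hilbert space, let $O \subset H$ be an open and convex subset, and let $f \colon O \to \mathbb{R}$ be convex. Then, for every $L > 0$, the following are equivalent. (i) $f$ is Gâteaux differentiable on $O$ and $f' \colon O \to H^\star$ is $L$-Lipschitz, i.e., $\|f'(y) - f'(x)\|_{H^\star} \le L \|y - x\|_H$ for all $x, y \in O$. (ii) The function $x \mapsto \frac{L}{2}\|x\|_H^2 - f(x)$ is convex on $O$ and $f$ is lower semicontinuous on $O$. (iii) $f$ is Gâteaux differentiable on $O$ and $f'$ is $1/L$-cocoercive, i.e., $\langle f'(y) - f'(x), y - x\rangle_H \ge \frac{1}{L}\|f'(y) - f'(x)\|_{H^\star}^2$ for all $x, y \in O$.
   Context: $H^\star$ denotes the topological dual of $H$ with the dual norm $\|\cdot\|_{H^\star}$, and $\langle \cdot, \cdot\rangle_H$ is the duality pairing between $H^\star$ and $H$. Gâteaux differentiability of $f$ at $x \in O$ means that there is a continuous linear functional $f'(x) \in H^\star$ with $\lim_{t \to 0} (f(x + t h) - f(x))/t = \langle f'(x), h\rangle_H$ for all $h \in H$. *)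

theory Defs
  imports "HOL-Analysis.Analysis"
begin

text \<open>The topological dual of a real normed space \<open>'a\<close> is the type \<open>'a \<Rightarrow>\<^sub>L real\<close> of bounded linear
  functionals, whose norm is the operator norm.\<close>

definition has_gateaux_derivative ::
  "('a::real_normed_vector \<Rightarrow> real) \<Rightarrow> ('a \<Rightarrow>\<^sub>L real) \<Rightarrow> 'a \<Rightarrow> bool"
  where "has_gateaux_derivative f D x \<longleftrightarrow>
    (\<forall>h. ((\<lambda>t::real. (f (x + t *\<^sub>R h) - f x) / t) \<longlongrightarrow> blinfun_apply D h) (at 0))"

text \<open>Only the values of \<open>f\<close> near \<open>x\<close> on lines through \<open>x\<close> matter, so on an open set \<open>S\<close> the following
  notion does not depend on the values of \<open>f\<close> outside \<open>S\<close>.\<close>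

definition gateaux_differentiable_on ::
  "('a::real_normed_vector \<Rightarrow> real) \<Rightarrow> 'a set \<Rightarrow> bool"
  where "gateaux_differentiable_on f S \<longleftrightarrow> (\<forall>x\<in>S. \<exists>D. has_gateaux_derivative f D x)"

definition gateaux_deriv ::
  "('a::real_normed_vector \<Rightarrow> real) \<Rightarrow> 'a \<Rightarrow> ('a \<Rightarrow>\<^sub>L real)"
  where "gateaux_deriv f x = (THE D. has_gateaux_derivative f D x)"

lemma has_gateaux_derivative_unique:
  assumes "has_gateaux_derivative f D x" "has_gateaux_derivative f E x"
  shows "D = E"
proof (rule blinfun_eqI)
  fix h
  show "blinfun_apply D h = blinfun_apply E h"
    using assms unfolding has_gateaux_derivative_def
    by (blast intro: tendsto_unique[OF at_neq_bot])
qed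

lemma gateaux_deriv_eq:
  "has_gateaux_derivative f D x \<Longrightarrow> gateaux_deriv f x = D"
  unfolding gateaux_deriv_def
  by (rule the_equality) (auto intro: has_gateaux_derivative_unique)

definition lower_semicontinuous_on ::
  "'a::topological_space set \<Rightarrow> ('a \<Rightarrow> real) \<Rightarrow> bool"
  where "lower_semicontinuous_on S f \<longleftrightarrow>
    (\<forall>x\<in>S. \<forall>c<f x. \<forall>\<^sub>F z in at x within S. c < f z)"

end

theory Submission
  imports Defs
begin

text \<open>For convex \<open>f\<close>, all three conditions say that \<open>f\<close> has, at every point \<open>x\<close> of \<open>U\<close>, a continuous linear functional
  \<open>D x\<close> with the two-sided estimate
  \<open>f x + D x (y - x) \<le> f y \<le> f x + D x (y - x) + L / 2 * (norm (y - x))\<^sup>2\<close> for all \<open>y\<close> in \<open>U\<close>.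
  The lower bound is convexity of \<open>f\<close>; the upper bound is, after subtracting both sides from
  \<open>L / 2 * (norm y)\<^sup>2\<close>, the tangent inequality that expresses convexity of \<open>L / 2 * (norm x)\<^sup>2 - f x\<close>. The proof runs
  through the cycle Lipschitz gradient, smoothness condition (ii), cocoercivity, Lipschitz gradient.

  A Lipschitz gradient gives the upper bound by differentiating along segments
  (\<open>descent_inequality\<close>); the two bounds then give (ii), since a function with a continuous affine
  minorant touching it at every point is convex and lower semicontinuous.

  Under (ii), the difference quotients of \<open>f\<close> on a line grow with the parameter, but not faster than
  linearly, because the same monotonicity holds for \<open>L / 2 * (norm x)\<^sup>2 - f x\<close>. Hence the two one-sided
  directional derivatives agree. The directional derivative is sublinear, as for every convex
  function, and odd, hence linear. Lower semicontinuity makes it bounded: the upper estimate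
  gives \<open>D x h \<ge> f (x + h) - f x - L / 2 * (norm h)\<^sup>2\<close>, and the right-hand side is bounded below
  for small \<open>h\<close>.

  Cocoercivity is the delicate step, because the classical argument compares \<open>f\<close> at \<open>x\<close> with \<open>f\<close> at the
  end of a gradient step from \<open>y\<close>, and that end may lie outside \<open>U\<close>. The two-sided estimate itself
  shows that the step is no longer than \<open>norm (y - x)\<close>, so the argument is valid when \<open>x\<close> and \<open>y\<close> are
  close to each other relative to their distance from the complement of \<open>U\<close> (\<open>cocoercive_near\<close>).
  Arbitrary \<open>x\<close> and \<open>y\<close> are joined by a segment that is cut into \<open>n\<close> equal short pieces with gradient
  increments \<open>G i\<close>; summing the local inequalities and using
  \<open>(norm (\<Sum>i<n. G i))\<^sup>2 \<le> n * (\<Sum>i<n. (norm (G i))\<^sup>2)\<close> reproduces exactly the constant \<open>1 / L\<close>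
  (\<open>cocoercive_along_segment\<close>). Finally, the Lipschitz bound follows from cocoercivity by estimating
  the pairing by the product of the norms.\<close>

section \<open>Convexity and tangents\<close>

text \<open>The point \<open>x\<close> is the convex combination of \<open>x + s *\<^sub>R h\<close> and \<open>x + t *\<^sub>R h\<close> with weights
  \<open>t / (t - s)\<close> and \<open>- s / (t - s)\<close>; clearing denominators in the convexity inequality gives the claim.\<close>
lemma convex_on_slopes_through_point:
  fixes f :: "'a::real_vector \<Rightarrow> real"
  assumes "convex_on U f" "s < 0" "0 < t" "x + s *\<^sub>R h \<in> U" "x + t *\<^sub>R h \<in> U"
  shows "(f (x + s *\<^sub>R h) - f x) / s \<le> (f (x + t *\<^sub>R h) - f x) / t"
proof -
  let ?u = "t / (t - s)" and ?v = "- s / (t - s)"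
  have uv: "0 \<le> ?u" "0 \<le> ?v" "?u + ?v = 1"
    using assms(2,3) by (auto simp: divide_simps)
  have "?u * s + ?v * t = 0"
    using assms(2,3) by (simp add: divide_simps)
  moreover have "?u *\<^sub>R (x + s *\<^sub>R h) + ?v *\<^sub>R (x + t *\<^sub>R h)
      = (?u + ?v) *\<^sub>R x + (?u * s + ?v * t) *\<^sub>R h"
    by (simp only: scaleR_add_right scaleR_add_left scaleR_scaleR add_ac)
  ultimately have "?u *\<^sub>R (x + s *\<^sub>R h) + ?v *\<^sub>R (x + t *\<^sub>R h) = x"
    unfolding uv(3) by simp
  then have "f x \<le> ?u * f (x + s *\<^sub>R h) + ?v * f (x + t *\<^sub>R h)"
    using assms(1,4,5) uv unfolding convex_on_def by metis
  also have "\<dots> = (t * f (x + s *\<^sub>R h) - s * f (x + t *\<^sub>R h)) / (t - s)"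
    by (simp add: diff_divide_distrib)
  finally have "f x * (t - s) \<le> t * f (x + s *\<^sub>R h) - s * f (x + t *\<^sub>R h)"
    using assms(2,3) by (simp add: pos_le_divide_eq)
  then show ?thesis
    using assms(2,3) by (simp add: divide_simps) (simp add: algebra_simps)
qed

text \<open>Convexity bounds the difference quotient for \<open>0 < t < 1\<close> by its value at \<open>t = 1\<close>. The slope \<open>d\<close>
  is a plain number, the limit in the one direction \<open>h\<close>, because the lemma serves to establish that
  directional derivatives form a continuous linear functional.\<close>
lemma convex_on_tangent_below:
  fixes f :: "'a::real_vector \<Rightarrow> real"
  assumes "convex_on U f" "x \<in> U" "x + h \<in> U"
    and lim: "((\<lambda>t. (f (x + t *\<^sub>R h) - f x) / t) \<longlongrightarrow> d) (at 0)"
  shows "f x + d \<le> f (x + h)"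
proof -
  have "(f (x + t *\<^sub>R h) - f x) / t \<le> f (x + h) - f x" if "0 < t" "t < 1" for t :: real
  proof -
    have "f ((1 - t) *\<^sub>R x + t *\<^sub>R (x + h)) \<le> (1 - t) * f x + t * f (x + h)"
      using convex_onD[OF assms(1)] assms(2,3) that by simp
    then show ?thesis
      using that by (simp add: field_simps)
  qed
  then have "\<forall>\<^sub>F t in at_right 0. (f (x + t *\<^sub>R h) - f x) / t \<le> f (x + h) - f x"
    unfolding eventually_at_right_field by (intro exI[of _ 1]) auto
  moreover have "((\<lambda>t. (f (x + t *\<^sub>R h) - f x) / t) \<longlongrightarrow> d) (at_right 0)"
    using lim filterlim_at_split by blast
  ultimately have "d \<le> f (x + h) - f x"
    by (intro tendsto_upperbound) auto
  then show ?thesis by simp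
qed

text \<open>At a convex combination \<open>z\<close> of \<open>x\<close> and \<open>y\<close>, average the two tangent inequalities based at \<open>z\<close>; the
  linear terms cancel because the weighted displacements from \<open>z\<close> sum to zero.\<close>
lemma convex_on_of_tangents:
  fixes f :: "'a::real_vector \<Rightarrow> real"
  assumes "convex U" "\<And>z. z \<in> U \<Longrightarrow> linear (D z)"
    and tangent: "\<And>z y. z \<in> U \<Longrightarrow> y \<in> U \<Longrightarrow> f z + D z (y - z) \<le> f y"
  shows "convex_on U f"
proof (rule convex_onI)
  fix t :: real and x y assume t: "0 < t" "t < 1" and xy: "x \<in> U" "y \<in> U"
  define z where "z = (1 - t) *\<^sub>R x + t *\<^sub>R y"
  have z: "z \<in> U"
    using assms(1) t xy unfolding z_def by (simp add: convex_alt)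
  interpret linear "D z" using assms(2)[OF z] .
  have "(1 - t) *\<^sub>R (x - z) + t *\<^sub>R (y - z) = 0"
    unfolding z_def by (simp add: algebra_simps)
  then have "(1 - t) * D z (x - z) + t * D z (y - z) = 0"
    by (metis add scale zero real_scaleR_def)
  moreover have "(1 - t) * (f z + D z (x - z)) \<le> (1 - t) * f x"
    "t * (f z + D z (y - z)) \<le> t * f y"
    using tangent[OF z] xy t by auto
  ultimately have "f z \<le> (1 - t) * f x + t * f y"
    by (simp add: algebra_simps)
  then show "f ((1 - t) *\<^sub>R x + t *\<^sub>R y) \<le> (1 - t) * f x + t * f y"
    by (simp add: z_def)
qed (fact assms(1))

lemma lower_semicontinuous_on_of_tangents:
  fixes f :: "'a::real_normed_vector \<Rightarrow> real" and D :: "'a \<Rightarrow> 'a \<Rightarrow>\<^sub>L real"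
  assumes "\<And>x y. x \<in> U \<Longrightarrow> y \<in> U \<Longrightarrow> f x + blinfun_apply (D x) (y - x) \<le> f y"
  shows "lower_semicontinuous_on U f"
  unfolding lower_semicontinuous_on_def
proof (intro ballI allI impI)
  fix x c assume x: "x \<in> U" and c: "c < f x"
  have "((\<lambda>z. f x + blinfun_apply (D x) (z - x)) \<longlongrightarrow> f x + blinfun_apply (D x) (x - x)) (at x within U)"
    by (intro tendsto_intros)
  then have "\<forall>\<^sub>F z in at x within U. c < f x + blinfun_apply (D x) (z - x)"
    using c by (intro order_tendstoD(1)[where y = "f x + blinfun_apply (D x) (x - x)"]) auto
  moreover have "\<forall>\<^sub>F z in at x within U. z \<in> U"
    by (simp add: eventually_at_filter)
  ultimately show "\<forall>\<^sub>F z in at x within U. c < f z"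
    by eventually_elim (use assms[OF x] in force)
qed

section \<open>Differentiability from two-sided convexity\<close>

text \<open>The supremum \<open>d\<close> of the values on the left separates both sides, and \<open>gap\<close> applied to \<open>t\<close> and \<open>- t\<close>
  bounds the distance of \<open>q t\<close> to \<open>d\<close> by \<open>2 * K * \<bar>t\<bar>\<close>.\<close>
lemma two_sided_limit_at_0:
  fixes q :: "real \<Rightarrow> real"
  assumes "0 < \<delta>"
    and mono: "\<And>s t. \<lbrakk>- \<delta> < s; s < 0; 0 < t; t < \<delta>\<rbrakk> \<Longrightarrow> q s \<le> q t"
    and gap: "\<And>s t. \<lbrakk>- \<delta> < s; s < 0; 0 < t; t < \<delta>\<rbrakk> \<Longrightarrow> q t - q s \<le> K * (t - s)"
  shows "\<exists>d. (q \<longlongrightarrow> d) (at 0)"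
proof -
  define d where "d = (SUP s\<in>{- \<delta><..<0}. q s)"
  have "bdd_above (q ` {- \<delta><..<0})"
    using mono[of _ "\<delta> / 2"] \<open>0 < \<delta>\<close> by (intro bdd_aboveI[of _ "q (\<delta> / 2)"]) auto
  then have left: "q s \<le> d" if "- \<delta> < s" "s < 0" for s
    unfolding d_def using that by (intro cSUP_upper) auto
  have right: "d \<le> q t" if "0 < t" "t < \<delta>" for t
    unfolding d_def using that mono \<open>0 < \<delta>\<close> by (intro cSUP_least) auto
  have "\<bar>q t - d\<bar> \<le> 2 * K * \<bar>t\<bar>" if "t \<noteq> 0" "\<bar>t\<bar> < \<delta>" for t
    using left[of t] left[of "- t"] right[of t] right[of "- t"] gap[of t "- t"] gap[of "- t" t] that
    by (cases "0 < t") auto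
  then have "\<forall>\<^sub>F t in at 0. norm (q t - d) \<le> 2 * K * \<bar>t\<bar>"
    unfolding eventually_at using \<open>0 < \<delta>\<close> by (intro exI[of _ \<delta>]) (auto simp: dist_real_def)
  moreover have "((\<lambda>t. 2 * K * \<bar>t\<bar>) \<longlongrightarrow> 0) (at 0)"
    by (intro tendsto_eq_intros) auto
  ultimately have "((\<lambda>t. q t - d) \<longlongrightarrow> 0) (at 0)"
    by (rule Lim_null_comparison)
  then show ?thesis
    using LIM_zero_iff by blast
qed

text \<open>The squared norm contributes the explicit term \<open>L * (x \<bullet> h) + L / 2 * (norm h)\<^sup>2 * t\<close>, so monotone
  slopes of \<open>L / 2 * (norm x)\<^sup>2 - f x\<close> become an upper bound for the growth of the slopes of \<open>f\<close>.\<close>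
lemma half_norm_square_minus_slope:
  fixes f :: "'a::real_inner \<Rightarrow> real"
  assumes "t \<noteq> 0"
  shows "((L / 2 * (norm (x + t *\<^sub>R h))\<^sup>2 - f (x + t *\<^sub>R h)) - (L / 2 * (norm x)\<^sup>2 - f x)) / t
    = L * (x \<bullet> h) + L / 2 * (norm h)\<^sup>2 * t - (f (x + t *\<^sub>R h) - f x) / t"
proof -
  have "(norm (x + t *\<^sub>R h))\<^sup>2 = (norm x)\<^sup>2 + 2 * t * (x \<bullet> h) + t * t * (norm h)\<^sup>2"
    by (simp add: power2_norm_eq_inner inner_add_left inner_add_right inner_commute)
  then show ?thesis
    using assms by (simp add: field_simps)
qed

lemma directional_derivative_exists:
  fixes f :: "'a::real_inner \<Rightarrow> real"
  assumes "open U" "x \<in> U" "convex_on U f" "convex_on U (\<lambda>x. L / 2 * (norm x)\<^sup>2 - f x)"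
  shows "\<exists>d. ((\<lambda>t. (f (x + t *\<^sub>R h) - f x) / t) \<longlongrightarrow> d) (at 0)"
proof -
  let ?q = "\<lambda>t. (f (x + t *\<^sub>R h) - f x) / t"
  have "((\<lambda>t. x + t *\<^sub>R h) \<longlongrightarrow> x) (at (0::real))"
    by (intro tendsto_eq_intros) auto
  then have "\<forall>\<^sub>F t in at (0::real). x + t *\<^sub>R h \<in> U"
    using topological_tendstoD assms(1,2) by blast
  then obtain \<delta> where \<delta>: "\<delta> > 0" "\<And>t. t \<noteq> 0 \<Longrightarrow> \<bar>t\<bar> < \<delta> \<Longrightarrow> x + t *\<^sub>R h \<in> U"
    unfolding eventually_at by (auto simp: dist_real_def)
  show ?thesis
  proof (rule two_sided_limit_at_0[OF \<delta>(1)])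
    fix s t :: real assume st: "- \<delta> < s" "s < 0" "0 < t" "t < \<delta>"
    then have U: "x + s *\<^sub>R h \<in> U" "x + t *\<^sub>R h \<in> U"
      using \<delta>(2)[of s] \<delta>(2)[of t] by auto
    show "?q s \<le> ?q t"
      by (rule convex_on_slopes_through_point[OF assms(3) st(2,3) U])
    have "s \<noteq> 0" "t \<noteq> 0" using st by auto
    then show "?q t - ?q s \<le> L / 2 * (norm h)\<^sup>2 * (t - s)"
      using convex_on_slopes_through_point[OF assms(4) st(2,3) U]
      unfolding half_norm_square_minus_slope[OF \<open>s \<noteq> 0\<close>] half_norm_square_minus_slope[OF \<open>t \<noteq> 0\<close>]
      by (simp only: right_diff_distrib)
  qed
qed

text \<open>This is the tangent inequality for \<open>L / 2 * (norm x)\<^sup>2 - f x\<close>, whose derivative at \<open>x\<close> in direction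
  \<open>h\<close> is \<open>L * (x \<bullet> h) - d\<close>.\<close>
lemma quadratic_upper_bound:
  fixes f :: "'a::real_inner \<Rightarrow> real"
  assumes "convex_on U (\<lambda>x. L / 2 * (norm x)\<^sup>2 - f x)" "x \<in> U" "x + h \<in> U"
    and lim: "((\<lambda>t. (f (x + t *\<^sub>R h) - f x) / t) \<longlongrightarrow> d) (at 0)"
  shows "f (x + h) \<le> f x + d + L / 2 * (norm h)\<^sup>2"
proof -
  let ?g = "\<lambda>x. L / 2 * (norm x)\<^sup>2 - f x"
  have "((\<lambda>t. L * (x \<bullet> h) + L / 2 * (norm h)\<^sup>2 * t - (f (x + t *\<^sub>R h) - f x) / t)
      \<longlongrightarrow> L * (x \<bullet> h) - d) (at 0)"
    by (rule tendsto_diff[OF _ lim]) (auto intro!: tendsto_eq_intros)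
  moreover have "\<forall>\<^sub>F t in at 0. L * (x \<bullet> h) + L / 2 * (norm h)\<^sup>2 * t - (f (x + t *\<^sub>R h) - f x) / t
      = (?g (x + t *\<^sub>R h) - ?g x) / t"
    unfolding eventually_at_filter
    by (intro always_eventually allI impI) (rule half_norm_square_minus_slope[symmetric])
  ultimately have "((\<lambda>t. (?g (x + t *\<^sub>R h) - ?g x) / t) \<longlongrightarrow> L * (x \<bullet> h) - d) (at 0)"
    by (rule Lim_transform_eventually)
  from convex_on_tangent_below[OF assms(1-3) this] show ?thesis
    by (simp add: power2_norm_eq_inner inner_add_left inner_add_right inner_commute field_simps)
qed

text \<open>The directional derivative \<open>d\<close> is homogeneous for all real factors, since its limit is two-sided;
  it is subadditive by convexity at midpoints, and oddness turns subadditivity into additivity.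
  Lower semicontinuity at \<open>x\<close> bounds \<open>f (x + h)\<close> below on a small sphere, and the quadratic upper bound
  transfers this to \<open>d h\<close>; applied to \<open>h\<close> and \<open>- h\<close>, it gives a bound for \<open>\<bar>d h\<bar>\<close>.\<close>
lemma has_gateaux_derivative_of_convex:
  fixes f :: "'a::real_inner \<Rightarrow> real"
  assumes "open U" "x \<in> U" "convex_on U f" "convex_on U (\<lambda>x. L / 2 * (norm x)\<^sup>2 - f x)"
    and lsc: "lower_semicontinuous_on U f"
  shows "\<exists>D. has_gateaux_derivative f D x"
proof -
  let ?q = "\<lambda>h t. (f (x + t *\<^sub>R h) - f x) / t"
  obtain d where d: "\<And>h. (?q h \<longlongrightarrow> d h) (at 0)"
    using directional_derivative_exists[OF assms(1-4)] by metis
  have lim_scale: "((\<lambda>t. ?q h (c * t)) \<longlongrightarrow> d h) (at 0)" if "c \<noteq> 0" for c h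
  proof -
    have "filterlim ((*) c) (at 0) (at 0)"
      unfolding filterlim_at using that
      by (auto intro!: tendsto_eq_intros simp: eventually_at_filter)
    from filterlim_compose[OF d this] show ?thesis by simp
  qed
  have scale: "d (c *\<^sub>R h) = c * d h" for c h
  proof (cases "c = 0")
    case True
    then show ?thesis
      using d[of 0] by (simp add: tendsto_const_iff)
  next
    case False
    have "((\<lambda>t. c * ?q h (c * t)) \<longlongrightarrow> c * d h) (at 0)"
      by (intro tendsto_intros lim_scale False)
    moreover have "c * ?q h (c * t) = ?q (c *\<^sub>R h) t" for t
      using False by (simp add: mult.commute)
    ultimately show ?thesis
      using d[of "c *\<^sub>R h"] LIM_unique by auto
  qed
  have nhds0: "\<forall>\<^sub>F t in at (0::real). x + t *\<^sub>R h \<in> U" for h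
  proof -
    have "((\<lambda>t. x + t *\<^sub>R h) \<longlongrightarrow> x) (at (0::real))"
      by (intro tendsto_eq_intros) auto
    then show ?thesis
      using topological_tendstoD assms(1,2) by blast
  qed
  have subadd: "d (h + k) \<le> d h + d k" for h k
  proof -
    have "\<forall>\<^sub>F t in at_right (0::real). x + t *\<^sub>R (2 *\<^sub>R h) \<in> U \<and> x + t *\<^sub>R (2 *\<^sub>R k) \<in> U"
      using nhds0[of "2 *\<^sub>R h"] nhds0[of "2 *\<^sub>R k"]
      by (intro eventually_conj) (auto simp: eventually_at_split)
    then have "\<forall>\<^sub>F t in at_right 0. ?q (h + k) t \<le> ?q h (2 * t) + ?q k (2 * t)"
      using eventually_at_right_less[of "0::real"]
    proof eventually_elim
      case (elim t)
      \<comment> \<open>\<open>x + t *\<^sub>R (h + k)\<close> is the midpoint of \<open>x + (2 * t) *\<^sub>R h\<close> and \<open>x + (2 * t) *\<^sub>R k\<close>.\<close>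
      have "f ((1 - 1/2) *\<^sub>R (x + (2 * t) *\<^sub>R h) + (1/2) *\<^sub>R (x + (2 * t) *\<^sub>R k))
          \<le> (1 - 1/2) * f (x + (2 * t) *\<^sub>R h) + 1/2 * f (x + (2 * t) *\<^sub>R k)"
        by (rule convex_onD[OF assms(3)]) (use elim in \<open>auto simp: mult.commute\<close>)
      also have "(1 - 1/2) *\<^sub>R (x + (2 * t) *\<^sub>R h) + (1/2) *\<^sub>R (x + (2 * t) *\<^sub>R k)
          = (1/2 + 1/2) *\<^sub>R x + t *\<^sub>R (h + k)"
        unfolding scaleR_add_left by (simp add: scaleR_add_right)
      finally have "2 * f (x + t *\<^sub>R (h + k)) - 2 * f x
          \<le> f (x + (2 * t) *\<^sub>R h) + f (x + (2 * t) *\<^sub>R k) - 2 * f x"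
        by simp
      from divide_right_mono[OF this, of "2 * t"] elim(2) show ?case
        by (simp add: add_divide_distrib diff_divide_distrib)
    qed
    moreover have "(?q (h + k) \<longlongrightarrow> d (h + k)) (at_right 0)"
      "((\<lambda>t. ?q h (2 * t) + ?q k (2 * t)) \<longlongrightarrow> d h + d k) (at_right 0)"
      using d[of "h + k"] tendsto_add[OF lim_scale[of 2 h] lim_scale[of 2 k]]
      by (auto simp: filterlim_at_split)
    ultimately show ?thesis
      by (intro tendsto_le[of "at_right (0::real)"]) auto
  qed
  have neg: "d (- h) = - d h" for h
    using scale[of "-1" h] by simp
  have add: "d (h + k) = d h + d k" for h k
    using subadd[of h k] subadd[of "- h" "- k"] neg[of h] neg[of k] neg[of "h + k"] by simp
  have upper: "f (x + h) \<le> f x + d h + L / 2 * (norm h)\<^sup>2" if "x + h \<in> U" for h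
    using quadratic_upper_bound[OF assms(4,2) that d] .
  have "\<forall>\<^sub>F z in at x within U. f x - 1 < f z"
    using lsc assms(2) unfolding lower_semicontinuous_on_def by auto
  then obtain r where r: "r > 0" "\<And>z. z \<in> U \<Longrightarrow> z \<noteq> x \<Longrightarrow> dist z x < r \<Longrightarrow> f x - 1 < f z"
    unfolding eventually_at by auto
  obtain \<rho> where \<rho>: "\<rho> > 0" "ball x \<rho> \<subseteq> U"
    using assms(1,2) open_contains_ball by blast
  \<comment> \<open>Halving keeps the sphere of radius \<open>\<epsilon>\<close> inside both open balls.\<close>
  define \<epsilon> where "\<epsilon> = min r \<rho> / 2"
  have \<epsilon>: "\<epsilon> > 0" "\<epsilon> < r" "\<epsilon> < \<rho>"
    using r \<rho> by (auto simp: \<epsilon>_def)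
  have below: "- (1 + L / 2 * \<epsilon>\<^sup>2) \<le> d h" if "norm h = \<epsilon>" for h
  proof -
    have "x + h \<in> U"
      using \<rho> \<epsilon> that by (auto simp: dist_norm)
    moreover have "x + h \<noteq> x" "dist (x + h) x < r"
      using \<epsilon> that by (auto simp: dist_norm)
    ultimately show ?thesis
      using r(2)[of "x + h"] upper[of h] that by auto
  qed
  have bound: "norm (d h) \<le> norm h * ((1 + L / 2 * \<epsilon>\<^sup>2) / \<epsilon>)" for h
  proof (cases "h = 0")
    case True
    then show ?thesis using scale[of 0 0] by simp
  next
    case False
    let ?c = "\<epsilon> / norm h"
    have c: "?c > 0" and n: "norm (?c *\<^sub>R h) = \<epsilon>" "norm (?c *\<^sub>R (- h)) = \<epsilon>"
      using False \<epsilon> by auto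
    have "\<bar>?c * d h\<bar> \<le> 1 + L / 2 * \<epsilon>\<^sup>2"
      using below[OF n(1)] below[OF n(2)] unfolding scale neg by (auto simp: abs_le_iff)
    then show ?thesis
      using False \<epsilon>(1) by (simp add: abs_mult field_simps)
  qed
  have "bounded_linear d"
    by (rule bounded_linear_intro[OF add _ bound]) (simp add: scale)
  then have "has_gateaux_derivative f (Blinfun d) x"
    unfolding has_gateaux_derivative_def using d by (simp add: bounded_linear_Blinfun_apply)
  then show ?thesis ..
qed

section \<open>Cocoercivity\<close>

text \<open>A bound on the ball of radius \<open>\<rho>\<close> bounds \<open>\<rho>\<close> times the dual norm. The product form includes
  \<open>\<rho> = 0\<close>, and it takes the place of choosing a vector at which the functional attains its norm.\<close>
lemma scaled_norm_blinfun_le: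
  fixes G :: "'a::real_normed_vector \<Rightarrow>\<^sub>L real"
  assumes "0 \<le> \<rho>" "\<And>w. norm w \<le> \<rho> \<Longrightarrow> blinfun_apply G w \<le> c"
  shows "\<rho> * norm G \<le> c"
proof (cases "\<rho> = 0")
  case True
  then show ?thesis using assms(2)[of 0] by simp
next
  case False
  then have \<rho>: "\<rho> > 0" using assms(1) by simp
  have c: "0 \<le> c" using assms(2)[of 0] assms(1) by simp
  have "norm G \<le> c / \<rho>"
  proof (rule norm_blinfun_bound)
    fix v :: 'a
    show "norm (blinfun_apply G v) \<le> c / \<rho> * norm v"
    proof (cases "v = 0")
      case False
      let ?c = "\<rho> / norm v"
      have "norm (?c *\<^sub>R v) \<le> \<rho>" "norm (?c *\<^sub>R (- v)) \<le> \<rho>"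
        using False \<rho> by auto
      from this[THEN assms(2)] have "\<bar>?c * blinfun_apply G v\<bar> \<le> c"
        by (simp add: abs_le_iff blinfun.scaleR_right blinfun.minus_right)
      then show ?thesis
        using False \<rho> by (simp add: abs_mult field_simps)
    qed simp
  qed (use c \<rho> in simp)
  then show ?thesis
    using \<rho> by (simp add: field_simps)
qed

text \<open>Subtracting the affine function that touches \<open>f\<close> at \<open>x\<close> leaves a function that is minimal at \<open>x\<close> and
  has derivative \<open>G = D y - D x\<close> at \<open>y\<close>. Its minimal value is at most its value at \<open>y - w\<close>, which
  the upper estimate at \<open>y\<close> controls; so \<open>G w\<close> is at most the gap \<open>E\<close> plus \<open>L / 2 * (norm w)\<^sup>2\<close>.
  The best length for \<open>w\<close> is \<open>norm G / L\<close>. It is admissible only if it does not exceed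
  \<open>norm (y - x)\<close>, which follows from the same inequality for \<open>w\<close> of length \<open>norm (y - x)\<close>, since the
  gap is at most \<open>L / 2 * (norm (y - x))\<^sup>2\<close>.\<close>
lemma tangent_gap_lower_bound:
  fixes f :: "'a::real_normed_vector \<Rightarrow> real" and D :: "'a \<Rightarrow> 'a \<Rightarrow>\<^sub>L real"
  assumes "L > 0"
    and lower: "\<And>x y. x \<in> U \<Longrightarrow> y \<in> U \<Longrightarrow> f x + blinfun_apply (D x) (y - x) \<le> f y"
    and upper: "\<And>x y. x \<in> U \<Longrightarrow> y \<in> U \<Longrightarrow>
      f y \<le> f x + blinfun_apply (D x) (y - x) + L / 2 * (norm (y - x))\<^sup>2"
    and x: "x \<in> U" and ball: "cball y (norm (y - x)) \<subseteq> U"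
  shows "(norm (D y - D x))\<^sup>2 / (2 * L) \<le> f y - f x - blinfun_apply (D x) (y - x)"
proof -
  define G where "G = D y - D x"
  define E where "E = f y - f x - blinfun_apply (D x) (y - x)"
  define \<delta> where "\<delta> = norm (y - x)"
  have y: "y \<in> U" using ball by auto
  have test: "blinfun_apply G w \<le> E + L / 2 * \<rho>\<^sup>2" if "norm w \<le> \<rho>" "\<rho> \<le> \<delta>" for w \<rho>
  proof -
    have "y - w \<in> U"
      using ball that by (auto simp: \<delta>_def dist_norm)
    then have "f x + blinfun_apply (D x) (y - w - x) \<le> f (y - w)"
      "f (y - w) \<le> f y + blinfun_apply (D y) (- w) + L / 2 * (norm w)\<^sup>2"
      using lower[OF x, of "y - w"] upper[OF y, of "y - w"] by auto
    moreover have "L / 2 * (norm w)\<^sup>2 \<le> L / 2 * \<rho>\<^sup>2"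
      using that \<open>L > 0\<close> by (simp add: power_mono)
    ultimately show ?thesis
      unfolding G_def E_def by (simp add: blinfun.diff_left blinfun.diff_right blinfun.minus_right)
  qed
  have scaled: "\<rho> * norm G \<le> E + L / 2 * \<rho>\<^sup>2" if "0 \<le> \<rho>" "\<rho> \<le> \<delta>" for \<rho>
    using test that by (intro scaled_norm_blinfun_le) auto
  have "norm G \<le> L * \<delta>"
  proof (cases "\<delta> = 0")
    case True
    then show ?thesis by (simp add: \<delta>_def G_def)
  next
    case False
    have "E \<le> L / 2 * \<delta>\<^sup>2"
      using upper[OF x y] by (simp add: E_def \<delta>_def)
    then have "\<delta> * norm G \<le> \<delta> * (L * \<delta>)"
      using scaled[of \<delta>] by (simp add: \<delta>_def power2_eq_square algebra_simps)
    then show ?thesis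
      using False by (simp add: \<delta>_def)
  qed
  \<comment> \<open>The full gradient step, of length \<open>norm G / L\<close>, is now known to stay in the ball.\<close>
  then have "norm G / L * norm G \<le> E + L / 2 * (norm G / L)\<^sup>2"
    using \<open>L > 0\<close> by (intro scaled) (auto simp: field_simps)
  then have "(norm G)\<^sup>2 / (2 * L) \<le> E"
    using \<open>L > 0\<close> by (simp add: power2_eq_square field_simps)
  then show ?thesis by (simp add: G_def E_def)
qed

text \<open>The gap bounds at \<open>x\<close> and at \<open>y\<close> add up: the values of \<open>f\<close> cancel and each contributes one half.\<close>
lemma cocoercive_near:
  fixes f :: "'a::real_normed_vector \<Rightarrow> real" and D :: "'a \<Rightarrow> 'a \<Rightarrow>\<^sub>L real"
  assumes "L > 0"
    and lower: "\<And>x y. x \<in> U \<Longrightarrow> y \<in> U \<Longrightarrow> f x + blinfun_apply (D x) (y - x) \<le> f y"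
    and upper: "\<And>x y. x \<in> U \<Longrightarrow> y \<in> U \<Longrightarrow>
      f y \<le> f x + blinfun_apply (D x) (y - x) + L / 2 * (norm (y - x))\<^sup>2"
    and balls: "cball x (norm (y - x)) \<subseteq> U" "cball y (norm (y - x)) \<subseteq> U"
  shows "1 / L * (norm (D y - D x))\<^sup>2 \<le> blinfun_apply (D y - D x) (y - x)"
proof -
  have xy: "x \<in> U" "y \<in> U" using balls by auto
  have "(norm (D y - D x))\<^sup>2 / (2 * L) \<le> f y - f x - blinfun_apply (D x) (y - x)"
    using tangent_gap_lower_bound[OF \<open>L > 0\<close> lower upper xy(1) balls(2)] .
  moreover have "(norm (D y - D x))\<^sup>2 / (2 * L) \<le> f x - f y + blinfun_apply (D y) (y - x)"
    using tangent_gap_lower_bound[OF \<open>L > 0\<close> lower upper xy(2), of x] balls(1)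
    by (simp add: norm_minus_commute blinfun.diff_right)
  ultimately show ?thesis
    by (simp add: blinfun.diff_left)
qed

text \<open>Cocoercivity is a local property on segments. On each of \<open>n\<close> equal pieces the displacement is
  \<open>(y - x) / n\<close>, so the sum of the local inequalities gains a factor \<open>1 / n\<close> on the side of the
  pairing, which is exactly the factor lost in the Cauchy-Schwarz inequality for the sum of the
  \<open>n\<close> gradient increments.\<close>
lemma cocoercive_along_segment:
  fixes D :: "'a::real_normed_vector \<Rightarrow> 'a \<Rightarrow>\<^sub>L real"
  assumes "L > 0" "\<epsilon> > 0"
    and near: "\<And>u v. u \<in> closed_segment x y \<Longrightarrow> v \<in> closed_segment x y \<Longrightarrow> norm (v - u) \<le> \<epsilon> \<Longrightarrow>
      1 / L * (norm (D v - D u))\<^sup>2 \<le> blinfun_apply (D v - D u) (v - u)"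
  shows "1 / L * (norm (D y - D x))\<^sup>2 \<le> blinfun_apply (D y - D x) (y - x)"
proof -
  obtain n :: nat where n: "norm (y - x) / \<epsilon> < real n" "n > 0"
    using reals_Archimedean2[of "norm (y - x) / \<epsilon>"] \<open>\<epsilon> > 0\<close>
    by (metis divide_nonneg_pos gr0I leD norm_ge_zero of_nat_0)
  define p where "p i = x + (real i / real n) *\<^sub>R (y - x)" for i
  define G where "G i = D (p (Suc i)) - D (p i)" for i
  have seg: "p i \<in> closed_segment x y" if "i \<le> n" for i
    unfolding in_segment p_def using that n(2)
    by (intro exI[of _ "real i / real n"]) (auto simp: algebra_simps)
  have step: "p (Suc i) - p i = (1 / real n) *\<^sub>R (y - x)" for i
    unfolding p_def by (simp add: add_divide_distrib scaleR_add_left)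
  have local: "1 / L * (norm (G i))\<^sup>2 \<le> blinfun_apply (G i) (y - x) / real n" if "i < n" for i
  proof -
    have "norm (p (Suc i) - p i) \<le> \<epsilon>"
      unfolding step norm_scaleR using n \<open>\<epsilon> > 0\<close> by (simp add: field_simps)
    from near[OF seg seg this] that show ?thesis
      by (simp add: G_def step blinfun.scaleR_right)
  qed
  have tele: "D y - D x = (\<Sum>i<n. G i)"
    unfolding G_def sum_lessThan_telescope[of "\<lambda>i. D (p i)"] using n(2) by (simp add: p_def)
  have "(norm (D y - D x))\<^sup>2 \<le> (\<Sum>i<n. norm (G i))\<^sup>2"
    unfolding tele by (intro power_mono norm_sum) simp
  also have "\<dots> \<le> (\<Sum>i<n. (norm (G i))\<^sup>2) * real n"
    using sum_squared_le_sum_of_squares[of "\<lambda>i. norm (G i)" "{..<n}"] by simp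
  finally have "1 / L * (norm (D y - D x))\<^sup>2 \<le> real n * (\<Sum>i<n. 1 / L * (norm (G i))\<^sup>2)"
    using \<open>L > 0\<close> by (simp add: field_simps flip: sum_divide_distrib)
  also have "\<dots> \<le> real n * (\<Sum>i<n. blinfun_apply (G i) (y - x) / real n)"
    by (intro mult_left_mono sum_mono local) auto
  also have "\<dots> = blinfun_apply (D y - D x) (y - x)"
    unfolding tele using n(2) by (simp add: blinfun.sum_left flip: sum_divide_distrib)
  finally show ?thesis .
qed

text \<open>By convexity of \<open>U\<close>, a radius that fits around both end points fits around every point of the
  segment, so the segment can be cut into pieces to which the local inequality applies.\<close>
lemma cocoercive_of_quadratic_bounds:
  fixes f :: "'a::real_normed_vector \<Rightarrow> real" and D :: "'a \<Rightarrow> 'a \<Rightarrow>\<^sub>L real"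
  assumes "open U" "convex U" "L > 0"
    and lower: "\<And>x y. x \<in> U \<Longrightarrow> y \<in> U \<Longrightarrow> f x + blinfun_apply (D x) (y - x) \<le> f y"
    and upper: "\<And>x y. x \<in> U \<Longrightarrow> y \<in> U \<Longrightarrow>
      f y \<le> f x + blinfun_apply (D x) (y - x) + L / 2 * (norm (y - x))\<^sup>2"
    and "x \<in> U" "y \<in> U"
  shows "1 / L * (norm (D y - D x))\<^sup>2 \<le> blinfun_apply (D y - D x) (y - x)"
proof -
  obtain a b where ab: "a > 0" "cball x a \<subseteq> U" "b > 0" "cball y b \<subseteq> U"
    using assms(1,6,7) open_contains_cball by metis
  define \<epsilon> where "\<epsilon> = min a b"
  have \<epsilon>: "\<epsilon> > 0" and ends: "cball x \<epsilon> \<subseteq> U" "cball y \<epsilon> \<subseteq> U"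
    using ab by (auto simp: \<epsilon>_def)
  have tube: "cball z \<epsilon> \<subseteq> U" if z: "z \<in> closed_segment x y" for z
  proof
    fix p assume "p \<in> cball z \<epsilon>"
    then have w: "norm (p - z) \<le> \<epsilon>" by (simp add: dist_norm norm_minus_commute)
    obtain t where t: "0 \<le> t" "t \<le> 1" "z = (1 - t) *\<^sub>R x + t *\<^sub>R y"
      using z by (auto simp: in_segment)
    have "x + (p - z) \<in> cball x \<epsilon>" "y + (p - z) \<in> cball y \<epsilon>"
      using w by (simp_all add: dist_norm norm_minus_commute)
    then have "x + (p - z) \<in> U" "y + (p - z) \<in> U"
      using ends by blast+
    then have "(1 - t) *\<^sub>R (x + (p - z)) + t *\<^sub>R (y + (p - z)) \<in> U"
      using \<open>convex U\<close> t(1,2) by (simp add: convex_alt)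
    moreover have "(1 - t) *\<^sub>R (x + (p - z)) + t *\<^sub>R (y + (p - z)) = p"
      using t(3) by (simp add: algebra_simps)
    ultimately show "p \<in> U" by simp
  qed
  show ?thesis
  proof (rule cocoercive_along_segment[OF \<open>L > 0\<close> \<epsilon>])
    fix u v assume "u \<in> closed_segment x y" "v \<in> closed_segment x y" "norm (v - u) \<le> \<epsilon>"
    then have "cball u (norm (v - u)) \<subseteq> U" "cball v (norm (v - u)) \<subseteq> U"
      using tube[of u] tube[of v] subset_cball[of "norm (v - u)" \<epsilon>] by blast+
    then show "1 / L * (norm (D v - D u))\<^sup>2 \<le> blinfun_apply (D v - D u) (v - u)"
      using cocoercive_near[OF \<open>L > 0\<close> lower upper] by blast
  qed
qed

section \<open>Consequences of a Lipschitz gradient\<close>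

text \<open>On the segment from \<open>x\<close> to \<open>y\<close>, the Lipschitz bound says that the difference \<open>\<psi>\<close> of \<open>f\<close> and the
  claimed majorant has nonpositive derivative.\<close>
lemma descent_inequality:
  fixes f :: "'a::real_normed_vector \<Rightarrow> real" and D :: "'a \<Rightarrow> 'a \<Rightarrow>\<^sub>L real"
  assumes "convex U" "x \<in> U" "y \<in> U"
    and D: "\<And>z. z \<in> U \<Longrightarrow> has_gateaux_derivative f (D z) z"
    and lip: "\<And>z. z \<in> U \<Longrightarrow> norm (D z - D x) \<le> L * norm (z - x)"
  shows "f y \<le> f x + blinfun_apply (D x) (y - x) + L / 2 * (norm (y - x))\<^sup>2"
proof -
  let ?h = "y - x"
  define \<psi> where "\<psi> t = f (x + t *\<^sub>R ?h) - t * blinfun_apply (D x) ?h - L / 2 * t\<^sup>2 * (norm ?h)\<^sup>2" for t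
  have "\<psi> 1 \<le> \<psi> 0"
  proof (rule DERIV_nonpos_imp_nonincreasing[of 0 1 \<psi>])
    fix t :: real assume t: "0 \<le> t" "t \<le> 1"
    let ?z = "x + t *\<^sub>R ?h"
    have "?z = (1 - t) *\<^sub>R x + t *\<^sub>R y" by (simp add: algebra_simps)
    then have z: "?z \<in> U"
      using assms(1-3) t by (simp add: convex_alt)
    have "((\<lambda>s. f (x + s *\<^sub>R ?h)) has_field_derivative blinfun_apply (D ?z) ?h) (at t)"
      using D[OF z] unfolding has_gateaux_derivative_def DERIV_def
      by (simp add: scaleR_add_left add.assoc)
    then have "(\<psi> has_field_derivative
        blinfun_apply (D ?z) ?h - blinfun_apply (D x) ?h - L * t * (norm ?h)\<^sup>2) (at t)"
      unfolding \<psi>_def by (auto intro!: derivative_eq_intros)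
    moreover have "blinfun_apply (D ?z) ?h - blinfun_apply (D x) ?h \<le> L * t * (norm ?h)\<^sup>2"
    proof -
      have "blinfun_apply (D ?z - D x) ?h \<le> norm (D ?z - D x) * norm ?h"
        using norm_blinfun[of "D ?z - D x" ?h] by simp
      also have "\<dots> \<le> (L * norm (?z - x)) * norm ?h"
        by (intro mult_right_mono lip z) simp
      also have "\<dots> = L * t * (norm ?h)\<^sup>2"
        using t by (simp add: power2_eq_square)
      finally show ?thesis by (simp add: blinfun.diff_left)
    qed
    ultimately show "\<exists>l. (\<psi> has_field_derivative l) (at t) \<and> l \<le> 0"
      by (intro exI conjI) auto
  qed simp
  then show ?thesis by (simp add: \<psi>_def)
qed

text \<open>Expanding \<open>(norm (y - x))\<^sup>2\<close> turns the upper estimate for \<open>f\<close> into a tangent inequality with slope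
  \<open>L * (x \<bullet> v) - D x v\<close> for \<open>L / 2 * (norm x)\<^sup>2 - f x\<close>.\<close>
lemma convex_on_quadratic_minus:
  fixes f :: "'a::real_inner \<Rightarrow> real" and D :: "'a \<Rightarrow> 'a \<Rightarrow>\<^sub>L real"
  assumes "convex U" and upper: "\<And>x y. x \<in> U \<Longrightarrow> y \<in> U \<Longrightarrow>
      f y \<le> f x + blinfun_apply (D x) (y - x) + L / 2 * (norm (y - x))\<^sup>2"
  shows "convex_on U (\<lambda>x. L / 2 * (norm x)\<^sup>2 - f x)"
proof (rule convex_on_of_tangents[where D = "\<lambda>z v. L * (z \<bullet> v) - blinfun_apply (D z) v"])
  show "linear (\<lambda>v. L * (z \<bullet> v) - blinfun_apply (D z) v)" for z
    by (rule linearI) (auto simp: inner_add_right blinfun.add_right blinfun.scaleR_right algebra_simps)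
  show "L / 2 * (norm z)\<^sup>2 - f z + (L * (z \<bullet> (y - z)) - blinfun_apply (D z) (y - z))
      \<le> L / 2 * (norm y)\<^sup>2 - f y" if "z \<in> U" "y \<in> U" for z y
    using upper[OF that]
    by (simp add: power2_norm_eq_inner inner_diff_left inner_diff_right inner_commute field_simps)
qed (fact assms(1))

section \<open>Equivalence of the three conditions\<close>

theorem theorem2p5:
  fixes U :: "'a::{real_inner, complete_space} set"
    and f :: "'a \<Rightarrow> real"
    and L :: real
  assumes "open U" and "convex U" and "convex_on U f" and "L > 0"
  shows "(gateaux_differentiable_on f U \<and> L-lipschitz_on U (gateaux_deriv f)
            \<longleftrightarrow> convex_on U (\<lambda>x. L / 2 * (norm x)\<^sup>2 - f x) \<and> lower_semicontinuous_on U f)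
       \<and> (convex_on U (\<lambda>x. L / 2 * (norm x)\<^sup>2 - f x) \<and> lower_semicontinuous_on U f
            \<longleftrightarrow> gateaux_differentiable_on f U \<and>
                (\<forall>x\<in>U. \<forall>y\<in>U. blinfun_apply (gateaux_deriv f y - gateaux_deriv f x) (y - x)
                   \<ge> 1 / L * (norm (gateaux_deriv f y - gateaux_deriv f x))\<^sup>2))"
  (is "(?diff \<and> ?lip \<longleftrightarrow> ?smooth) \<and> (?smooth \<longleftrightarrow> ?diff \<and> ?coco)")
proof -
  let ?D = "gateaux_deriv f"
  have deriv: "has_gateaux_derivative f (?D x) x" if ?diff "x \<in> U" for x
    using that gateaux_deriv_eq unfolding gateaux_differentiable_on_def by blast
  have lower: "f x + blinfun_apply (?D x) (y - x) \<le> f y" if ?diff "x \<in> U" "y \<in> U" for x y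
    using convex_on_tangent_below[OF \<open>convex_on U f\<close>, of x "y - x"] deriv that
    by (simp add: has_gateaux_derivative_def)
  have "?smooth" if ?diff ?lip
  proof -
    have "norm (?D z - ?D x) \<le> L * norm (z - x)" if "z \<in> U" "x \<in> U" for x z
      using lipschitz_onD[OF \<open>?lip\<close>] that by (simp add: dist_norm)
    then have "f y \<le> f x + blinfun_apply (?D x) (y - x) + L / 2 * (norm (y - x))\<^sup>2"
      if "x \<in> U" "y \<in> U" for x y
      using descent_inequality[OF \<open>convex U\<close> that, of f ?D L] deriv \<open>?diff\<close> that by blast
    then show ?thesis
      using convex_on_quadratic_minus[OF \<open>convex U\<close>] lower_semicontinuous_on_of_tangents
        lower[OF \<open>?diff\<close>] by blast
  qed
  moreover have "?diff \<and> ?coco" if ?smooth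
  proof
    show ?diff
      unfolding gateaux_differentiable_on_def
      using has_gateaux_derivative_of_convex \<open>?smooth\<close> \<open>open U\<close> \<open>convex_on U f\<close> by blast
    have "f y \<le> f x + blinfun_apply (?D x) (y - x) + L / 2 * (norm (y - x))\<^sup>2"
      if "x \<in> U" "y \<in> U" for x y
      using quadratic_upper_bound[of U L f x "y - x"] \<open>?smooth\<close> that deriv[OF \<open>?diff\<close>]
      by (simp add: has_gateaux_derivative_def)
    then show ?coco
      using cocoercive_of_quadratic_bounds[OF \<open>open U\<close> \<open>convex U\<close> \<open>L > 0\<close>] lower[OF \<open>?diff\<close>] by blast
  qed
  moreover have "?lip" if ?coco
  proof (rule lipschitz_onI)
    fix x y assume "x \<in> U" "y \<in> U"
    let ?G = "?D x - ?D y"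
    have "1 / L * (norm ?G)\<^sup>2 \<le> blinfun_apply ?G (x - y)"
      using \<open>?coco\<close> \<open>x \<in> U\<close> \<open>y \<in> U\<close> by blast
    also have "\<dots> \<le> norm ?G * norm (x - y)"
      using norm_blinfun[of ?G "x - y"] by simp
    finally have "norm ?G * norm ?G \<le> norm ?G * (L * norm (x - y))"
      using \<open>L > 0\<close> by (simp add: field_simps power2_eq_square)
    then show "dist (?D x) (?D y) \<le> L * dist x y"
      using \<open>L > 0\<close> by (cases "norm ?G = 0") (auto simp: dist_norm)
  qed (use \<open>L > 0\<close> in simp)
  ultimately show ?thesis by blast
qed

end
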